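(* Let $b$ and $c$ be positive integers such that $b$ is odd and $c$ is even. Then there is an integer $n$ with $1 < n \leq \max\{b,c\}$ such that $n^2 + bn + c$ is a practical number.
   Context: A positive integer $N$ is called a practical number if every positive integer less than or equal to $N$ can be expressed as a sum of distinct positive divisors of $N$. *)

theory Defs
  imports Main
begin

definition practical :: "nat \<Rightarrow> bool" where
  "practical N \<longleftrightarrow>
     0 < N \<and> (\<forall>m. 0 < m \<and> m \<le> N \<longrightarrow> (\<exists>D \<subseteq> {d. d dvd N}. m = \<Sum>D))"

end

theory Submission
  imports Defs
begin

text \<open>
  Choose k with P = 2^k \<le> max b c < 2P. Since b is odd, n^2 + b n + c is divisible by P for two
  distinct residues x < y in [0, P), and x + y + b is divisible by P. One of x, y, P always gives a
  value at most 2P^2 that is divisible by P, or the value 2P^2 or 3P^2, and 2^i q is practical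
  whenever 0 < q \<le> 2^(i+1).
\<close>

lemma binary_subset_sum:
  fixes s :: nat
  assumes "s < 2 ^ n"
  shows "\<exists>I \<subseteq> {..<n}. s = (\<Sum>i\<in>I. 2 ^ i)"
  using assms
proof (induction n arbitrary: s)
  case 0
  then show ?case by auto
next
  case (Suc n)
  show ?case
  proof (cases "s < 2 ^ n")
    case True
    with Suc.IH obtain I where "I \<subseteq> {..<n}" "s = (\<Sum>i\<in>I. 2 ^ i)" by blast
    then show ?thesis by (intro exI[of _ I]) auto
  next
    case False
    with Suc.prems have "s - 2 ^ n < 2 ^ n" by simp
    with Suc.IH obtain I where I: "I \<subseteq> {..<n}" "s - 2 ^ n = (\<Sum>i\<in>I. 2 ^ i)" by blast
    moreover from I(1) have "finite I" "n \<notin> I" by (auto intro: finite_subset)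
    ultimately have "s = (\<Sum>i\<in>insert n I. 2 ^ i)" using False by simp
    with I(1) show ?thesis by (intro exI[of _ "insert n I"]) auto
  qed
qed

text \<open>Divide \<open>m\<close> by \<open>q\<close> and expand quotient and remainder in binary.
  The quotient is at most \<open>2^k\<close> and the remainder is below \<open>q\<close>, so all
  exponents stay at most \<open>k\<close>, and the terms \<open>2^i * q\<close> and
  \<open>2^j\<close> divide \<open>2^k * q\<close>. As \<open>q\<close> is odd, the two families can
  only meet when \<open>q = 1\<close>, and then the remainder is 0.\<close>

lemma practical_power_two_mult_odd:
  assumes "odd q" and "q \<le> 2 ^ Suc k"
  shows "practical (2 ^ k * q)"
  unfolding practical_def
proof (intro conjI allI impI)
  show "0 < 2 ^ k * q" using assms(1) by (auto intro: odd_pos)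
next
  fix m :: nat
  assume m: "0 < m \<and> m \<le> 2 ^ k * q"
  have "q > 0" using assms(1) by (rule odd_pos)
  have "m div q \<le> 2 ^ k" using m div_le_mono[of m "2 ^ k * q" q] \<open>q > 0\<close> by simp
  then have "m div q < 2 ^ Suc k" by (simp add: less_2_cases_iff le_less_trans)
  then obtain I where I: "I \<subseteq> {..<Suc k}" "m div q = (\<Sum>i\<in>I. 2 ^ i)"
    using binary_subset_sum by blast
  have "m mod q < 2 ^ Suc k" using \<open>q > 0\<close> assms(2) mod_less_divisor less_le_trans by blast
  then obtain J where J: "J \<subseteq> {..<Suc k}" "m mod q = (\<Sum>j\<in>J. 2 ^ j)"
    using binary_subset_sum by blast
  let ?A = "(\<lambda>i. 2 ^ i * q) ` I" and ?B = "(\<lambda>j. 2 ^ j) ` J :: nat set"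
  have fin: "finite I" "finite J" using I(1) J(1) finite_subset by auto
  have "\<Sum>?A = (\<Sum>i\<in>I. 2 ^ i * q)"
    by (rule sum.reindex_cong[of "\<lambda>i. 2 ^ i * q"]) (use \<open>q > 0\<close> in \<open>auto intro!: inj_onI\<close>)
  then have A: "\<Sum>?A = m div q * q" using I(2) by (simp add: sum_distrib_right)
  have B: "\<Sum>?B = m mod q"
    unfolding J(2) by (rule sum.reindex_cong[of "\<lambda>i. 2 ^ i"]) (auto intro!: inj_onI)
  have disj: "?A \<inter> ?B = {}"
  proof (cases "q = 1")
    case True
    then have "J = {}" using J(2) fin by (simp add: sum_eq_0_iff)
    then show ?thesis by simp
  next
    case False
    have "2 ^ i * q \<noteq> 2 ^ j" for i j :: nat
    proof
      assume "2 ^ i * q = 2 ^ j"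
      then have "q dvd 2 ^ j" by (metis dvd_triv_right)
      moreover have "coprime q (2 ^ j)" using assms(1) by simp
      ultimately have "is_unit q" using coprime_common_divisor dvd_refl by blast
      then show False using False by simp
    qed
    then show ?thesis by blast
  qed
  have "m = \<Sum>(?A \<union> ?B)"
    using fin A B disj by (simp add: sum.union_disjoint)
  moreover have "?A \<union> ?B \<subseteq> {d. d dvd 2 ^ k * q}"
  proof -
    have "2 ^ i * q dvd 2 ^ k * q" if "i \<in> I" for i
      using that I(1) by (intro mult_dvd_mono le_imp_power_dvd) auto
    moreover have "2 ^ j dvd 2 ^ k * q" if "j \<in> J" for j
      using that J(1) by (intro dvd_mult2 le_imp_power_dvd) auto
    ultimately show ?thesis by blast
  qed
  ultimately show "\<exists>D\<subseteq>{d. d dvd 2 ^ k * q}. m = \<Sum>D" by blast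
qed

text \<open>Factors 2 of \<open>q\<close> move into the power until the cofactor is odd. The bound
  survives, since \<open>q\<close> halves while \<open>2 ^ Suc k\<close> doubles.\<close>

lemma practical_power_two_mult:
  assumes "0 < q" and "q \<le> 2 ^ Suc k"
  shows "practical (2 ^ k * q)"
  using assms
proof (induction q arbitrary: k rule: less_induct)
  case (less q)
  show ?case
  proof (cases "odd q")
    case True
    then show ?thesis using less.prems practical_power_two_mult_odd by blast
  next
    case False
    then obtain r where r: "q = 2 * r" by blast
    have "practical (2 ^ Suc k * r)" by (rule less.IH) (use less.prems r in simp_all)
    then show ?thesis using r by (simp add: ac_simps)
  qed
qed

lemma practical_if_dvd_le:
  assumes "2 ^ k dvd N" and "0 < N" and "N \<le> 2 * 2 ^ k * 2 ^ k"
  shows "practical N"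
proof -
  obtain q where "N = 2 ^ k * q" using assms(1) by blast
  moreover from this have "0 < q" "q \<le> 2 ^ Suc k" using assms by simp_all
  ultimately show ?thesis using practical_power_two_mult by simp
qed

text \<open>Hensel lifting: adding \<open>2 ^ Suc k\<close> to \<open>x\<close> changes the value by
  \<open>2 ^ Suc k\<close> times an odd number, because \<open>b\<close> is odd. This flips the
  parity of the cofactor \<open>q\<close>, so one of the two candidates is a root modulo the next
  power.\<close>

lemma ex_root_mod_power_two:
  fixes b c :: nat
  assumes "odd b" and "even c"
  shows "\<exists>x. 2 ^ Suc k dvd x * (x + b) + c"
proof (induction k)
  case 0
  show ?case using assms by (intro exI[of _ 0]) simp
next
  case (Suc k)
  then obtain x q where x: "x * (x + b) + c = 2 ^ Suc k * q" by blast
  show ?case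
  proof (cases "even q")
    case True
    then obtain r where "q = 2 * r" by blast
    then have "x * (x + b) + c = 2 ^ Suc (Suc k) * r" using x by simp
    then show ?thesis by (metis dvd_triv_left)
  next
    case False
    let ?y = "x + 2 ^ Suc k"
    have "?y * (?y + b) + c = (x * (x + b) + c) + 2 ^ Suc k * (2 * x + b + 2 ^ Suc k)"
      by (simp add: algebra_simps)
    also have "\<dots> = 2 ^ Suc k * (q + 2 * x + b + 2 ^ Suc k)"
      unfolding x by (simp add: algebra_simps)
    also have "2 ^ Suc (Suc k) dvd \<dots>"
    proof -
      have "even (q + 2 * x + b + 2 ^ Suc k)" using False assms by simp
      then show ?thesis by (simp only: power_Suc2[of 2 "Suc k"] mult_dvd_mono dvd_refl)
    qed
    finally show ?thesis by blast
  qed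
qed

text \<open>The reflection \<open>n \<mapsto> - n - b\<close> preserves \<open>n * (n + b)\<close>,
  so it sends a root to a root. Modulo an even \<open>P\<close> it has no fixed point, because
  \<open>b\<close> is odd.\<close>

lemma ex_two_roots_mod_power_two:
  fixes b c :: nat
  assumes "odd b" and "even c" and "0 < k"
  obtains x y where "x < y" "y < 2 ^ k" "2 ^ k dvd x + y + b"
    "2 ^ k dvd x * (x + b) + c" "2 ^ k dvd y * (y + b) + c"
proof -
  define P :: nat where "P = 2 ^ k"
  have P: "P > 0" "even P" using assms(3) by (auto simp: P_def)
  obtain z where z: "P dvd z * (z + b) + c"
    using ex_root_mod_power_two[OF assms(1,2), of "k - 1"] assms(3) by (auto simp: P_def)
  define e where "e = z mod P"
  \<comment> \<open>The reflected root, computed in the integers because \<open>- e - b\<close> is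
    negative, then reduced to [0, \<open>P\<close>).\<close>
  define f where "f = nat ((- int e - int b) mod int P)"
  have bd: "e < P" "f < P" using P by (auto simp: e_def f_def nat_less_iff)
  have "z = e + P * (z div P)" by (simp add: e_def)
  then have "z * (z + b) + c = e * (e + b) + c + P * (z div P * (z + e + b))"
    by algebra
  then have e: "P dvd e * (e + b) + c" using z by (metis dvd_add_left_iff dvd_triv_left)
  have "int f = (- int e - int b) mod int P" using P by (simp add: f_def)
  then have "int P dvd int f - (- int e - int b)"
    by (metis mod_eq_dvd_iff mod_mod_trivial)
  then have "int P dvd int (e + f + b)" by (simp add: algebra_simps)
  then have s: "P dvd e + f + b" by (simp only: int_dvd_int_iff)
  have "int (f * (f + b) + c) = int (e * (e + b) + c) + (int f - int e) * int (e + f + b)"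
    by (simp add: algebra_simps)
  moreover have "int P dvd int (e * (e + b) + c) + (int f - int e) * int (e + f + b)"
    using e s by (intro dvd_add dvd_mult) (simp_all only: int_dvd_int_iff)
  ultimately have f: "P dvd f * (f + b) + c" by (metis int_dvd_int_iff)
  have "even (e + f + b)" using s P dvd_trans by blast
  then have "e \<noteq> f" using assms(1) by auto
  then consider "e < f" | "f < e" by linarith
  then show ?thesis
  proof cases
    case 1
    then show ?thesis using that[of e f] bd s e f by (simp add: P_def)
  next
    case 2
    then show ?thesis using that[of f e] bd s e f by (simp add: P_def add.commute)
  qed
qed

theorem theorem1:
  fixes b c :: nat
  assumes "0 < b" and "0 < c" and "odd b" and "even c"
  shows "\<exists>n::nat. 1 < n \<and> n \<le> max b c \<and> practical (n\<^sup>2 + b * n + c)"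
proof -
  have "2 \<le> c" using assms by (auto elim!: evenE)
  then have "1 \<le> max b c" by simp
  then obtain k where k: "2 ^ k \<le> max b c" "max b c < 2 ^ (k + 1)"
    using ex_power_ivl1[of 2 "max b c"] by blast
  define P :: nat where "P = 2 ^ k"
  have P: "P \<le> max b c" "b < 2 * P" "c < 2 * P" using k by (auto simp: P_def)
  have "k \<noteq> 0" using k \<open>2 \<le> c\<close> by (intro notI) simp
  have "even P" "2 \<le> P" using \<open>k \<noteq> 0\<close> self_le_power[of 2 k] by (auto simp: P_def)
  obtain x y where xy: "x < y" "y < P" "P dvd x + y + b"
    "P dvd x * (x + b) + c" "P dvd y * (y + b) + c"
    using ex_two_roots_mod_power_two[of b c k] assms \<open>k \<noteq> 0\<close> by (auto simp: P_def)
  have small: ?thesis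
    if "1 < n" "n < P" "P dvd n * (n + b) + c" "n * (n + b) + c \<le> 2 * P * P" for n
  proof -
    have "practical (n * (n + b) + c)"
      using that assms(2) by (intro practical_if_dvd_le[of k]) (auto simp: P_def)
    then show ?thesis using that P
      by (intro exI[of _ n]) (simp add: power2_eq_square algebra_simps)
  qed
  \<comment> \<open>Neither root exceeds 1 here, so \<open>n = P\<close> is taken. The root 0 gives
    \<open>P dvd c\<close>, hence \<open>c = P\<close> as \<open>0 < c < 2 * P\<close>, and the
    value becomes \<open>(a + 1) * P^2\<close>.\<close>
  have P_works: ?thesis if "x = 0" "y = 1" "b + 1 = a * P" "a = 1 \<or> a = 2" for a
  proof -
    have "P dvd c" using xy that by simp
    then obtain d where "c = P * d" by blast
    then have "c = P" using P(3) \<open>0 < c\<close> \<open>2 \<le> P\<close> by (cases d) auto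
    then have "P\<^sup>2 + b * P + c = P\<^sup>2 + (b + 1) * P" by simp
    also note \<open>b + 1 = a * P\<close>
    also have "P\<^sup>2 + a * P * P = 2 ^ (2 * k) * (a + 1)"
      by (simp add: P_def power2_eq_square algebra_simps power_add mult_2_right)
    finally have eq: "P\<^sup>2 + b * P + c = 2 ^ (2 * k) * (a + 1)" .
    \<comment> \<open>Since \<open>a + 1 \<le> 3 < 2 ^ 2\<close>, this bounds the cofactor of
      \<open>2 ^ (2 * k)\<close>.\<close>
    have "(2::nat) ^ 2 \<le> 2 ^ Suc (2 * k)"
      using \<open>k \<noteq> 0\<close> by (intro power_increasing) auto
    then have "practical (2 ^ (2 * k) * (a + 1))"
      using that by (intro practical_power_two_mult) auto
    then show ?thesis using eq P(1) \<open>2 \<le> P\<close> by (intro exI[of _ P]) simp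
  qed
  show ?thesis
  proof (cases "b < P")
    case True
    show ?thesis
    proof (cases "1 < y")
      case y: True
      \<comment> \<open>The factor \<open>P - 1\<close> leaves a slack of \<open>2 * P\<close>,
        which absorbs \<open>c\<close>.\<close>
      have "y * (y + b) \<le> (P - 1) * (2 * P)"
        using xy True by (intro mult_le_mono) auto
      moreover have "(P - 1) * (2 * P) + 2 * P = 2 * P * P"
        using \<open>2 \<le> P\<close> by (cases P) simp_all
      ultimately have "y * (y + b) + c \<le> 2 * P * P" using P(3) by linarith
      then show ?thesis using small[of y] y xy by blast
    next
      case False
      then have 01: "x = 0" "y = 1" using xy by auto
      then obtain d where d: "b + 1 = P * d" using xy(3) by (auto simp: dvd_def)
      have "P * d < P * 2" using d True \<open>2 \<le> P\<close> by linarith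
      then have "d < 2" by simp
      moreover have "d \<noteq> 0" using d by (intro notI) simp
      ultimately have "d = 1" by simp
      then show ?thesis using P_works[of 1] 01 d by simp
    qed
  next
    case False
    \<comment> \<open>Subtracting \<open>P\<close> from \<open>b\<close> leaves
      \<open>x + y + r\<close> a positive multiple of \<open>P\<close> below \<open>3 * P\<close>,
      so it is \<open>P\<close> or \<open>2 * P\<close>.\<close>
    define r where "r = b - P"
    have b: "b = P + r" "odd r" "r < P"
      using False P \<open>odd b\<close> \<open>even P\<close> by (auto simp: r_def)
    have "P dvd x + y + r" using xy(3) unfolding b by (metis add.assoc add.commute dvd_add_triv_right_iff)
    then obtain d where d: "x + y + r = P * d" by blast
    have "P * d < P * 3" using d b xy by linarith
    then have "d < 3" by simp
    moreover have "d \<noteq> 0" using d xy(1) by (intro notI) simp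
    ultimately consider "d = 1" | "d = 2" by linarith
    then show ?thesis
    proof cases
      case 1
      then have sum: "x + y + r = P" using d by simp
      show ?thesis
      proof (cases "1 < y")
        case y: True
        \<comment> \<open>The sum condition gives
          \<open>y + b = P + (y + r) \<le> 2 * P\<close>.\<close>
        have "y * (y + b) \<le> (P - 1) * (2 * P)"
          using xy sum b by (intro mult_le_mono) auto
        moreover have "(P - 1) * (2 * P) + 2 * P = 2 * P * P"
          using \<open>2 \<le> P\<close> by (cases P) simp_all
        ultimately have "y * (y + b) + c \<le> 2 * P * P" using P(3) by linarith
        then show ?thesis using small[of y] y xy by blast
      next
        case False
        then have "x = 0" "y = 1" using xy by auto
        then show ?thesis using P_works[of 2] sum b by simp
      qed
    next
      case 2
      then have sum: "x + y + r = 2 * P" using d by simp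
      \<comment> \<open>The bound on \<open>y + b\<close> is no longer available, so the smaller
        root \<open>x\<close> is used. From \<open>x < y\<close> follows
        \<open>2 * x + r < 2 * P\<close>, that is \<open>x + t + 1 \<le> P\<close>, and
        \<open>u\<close> is the slack.\<close>
      obtain t where t: "r = 2 * t + 1" using b(2) by (rule oddE)
      have "x + t + 1 \<le> P" using sum t xy(1) by linarith
      then obtain u where u: "P = x + t + 1 + u" using le_Suc_ex by blast
      \<comment> \<open>Both \<open>y\<close> and \<open>r\<close> are at most \<open>P - 1\<close>,
        and the three numbers sum to \<open>2 * P\<close>.\<close>
      have "1 < x" using sum xy b by linarith
      have "x * (x + b) + c \<le> 2 * P * P"
      proof -
        have "x * (x + b) + 2 * P \<le> 2 * P * P"
        proof -
          \<comment> \<open>The excess \<open>t\<close> of \<open>x + b\<close> over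
            \<open>2 * P\<close> costs at most \<open>x * t\<close>, which the gap between
            \<open>x\<close> and \<open>P\<close> pays for: \<open>P - x = t + u + 1\<close>, whose
            last unit keeps \<open>2 * P\<close> free for \<open>c\<close>.\<close>
          have "x * t \<le> 2 * P * (t + u)" using u by (intro mult_le_mono) auto
          moreover have "x + b \<le> 2 * P + t" using b t u by linarith
          then have "x * (x + b) \<le> 2 * P * x + x * t"
            by (metis mult.commute mult_le_mono2 distrib_left)
          moreover have "2 * P * P = 2 * P * x + 2 * P * (t + u) + 2 * P"
            using arg_cong[OF u, of "\<lambda>v. 2 * P * v"] by (simp add: distrib_left)
          ultimately show ?thesis by linarith
        qed
        then show ?thesis using P(3) by linarith
      qed
      then show ?thesis using small[of x] \<open>1 < x\<close> xy by simp
    qed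
  qed
qed

end
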